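(* Let $V$ be a finite set with $n=|V|$. Any (deterministic) algorithm that solves the posimodular function minimization problem on $V$ — i.e., given value-oracle access to an arbitrary posimodular function $f:2^V\to\mathbb{R}$, outputs a nonempty subset $X^*\subseteq V$ with $f(X^* )=\min\{f(X)\mid X\subseteq V,\ X\neq\emptyset\}$ together with the value $f(X^* )$ — requires $\Omega(2^{n/7.54})$ oracle calls in the worst case.
   Context: A set function $f:2^V\to\mathbb{R}$ is posimodular if $f(X)+f(Y)\ge f(X\setminus Y)+f(Y\setminus X)$ for all $X,Y\subseteq V$. The function $f$ is accessible only through an oracle that returns $f(X)$ for a queried subset $X\subseteq V$. Throughout, $f(\emptyset)=0$ is assumed (normalization). *)

theory Defs
  imports Complex_Main "HOL-Library.Landau_Symbols"
begin

text \<open>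
  A set function on \<open>2\<^sup>V\<close> is represented by a total function on \<open>'a set\<close>; only its values on
  subsets of \<open>V\<close> are ever constrained or consulted.
\<close>

definition posimodular_on :: "'a set \<Rightarrow> ('a set \<Rightarrow> real) \<Rightarrow> bool" where
  "posimodular_on V f \<longleftrightarrow>
     (\<forall>X Y. X \<subseteq> V \<longrightarrow> Y \<subseteq> V \<longrightarrow> f X + f Y \<ge> f (X - Y) + f (Y - X))"

definition posimodular_inputs :: "'a set \<Rightarrow> ('a set \<Rightarrow> real) set" where
  "posimodular_inputs V = {f. posimodular_on V f \<and> f {} = 0}"

definition is_minimum :: "'a set \<Rightarrow> ('a set \<Rightarrow> real) \<Rightarrow> 'a set \<Rightarrow> real \<Rightarrow> bool" where
  "is_minimum V f X v \<longleftrightarrow>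
     X \<subseteq> V \<and> X \<noteq> {} \<and> f X = Min {f Y | Y. Y \<subseteq> V \<and> Y \<noteq> {}} \<and> v = f X"

text \<open>
  A deterministic oracle algorithm is its strategy: the list of oracle answers received so far
  (oldest first) determines the next move. The earlier queries need not be recorded, as they are
  themselves determined by the answers preceding them. Computation between oracle calls is
  unrestricted, so a lower bound in this model holds for every concrete model of computation.
\<close>

datatype 'a move = Query "'a set" | Output "'a set" real

type_synonym 'a algorithm = "real list \<Rightarrow> 'a move"

text \<open>The answers received within the first \<open>k\<close> oracle calls, fewer if the run stops earlier:\<close>

primrec answers :: "'a algorithm \<Rightarrow> ('a set \<Rightarrow> real) \<Rightarrow> nat \<Rightarrow> real list" where
  "answers A f 0 = []"
| "answers A f (Suc k) =
     (case A (answers A f k) of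
        Query X \<Rightarrow> answers A f k @ [f X]
      | Output X v \<Rightarrow> answers A f k)"

definition outputs :: "'a algorithm \<Rightarrow> ('a set \<Rightarrow> real) \<Rightarrow> 'a set \<Rightarrow> real \<Rightarrow> bool" where
  "outputs A f X v \<longleftrightarrow> (\<exists>k. A (answers A f k) = Output X v)"

text \<open>Meaningful for terminating runs only; repeated queries are counted each time.\<close>

definition num_calls :: "'a algorithm \<Rightarrow> ('a set \<Rightarrow> real) \<Rightarrow> nat" where
  "num_calls A f = (LEAST k. \<exists>X v. A (answers A f k) = Output X v)"

text \<open>
  Termination and correct behaviour are demanded only on posimodular inputs; on other oracles the
  algorithm may do anything.
\<close>

definition solves_posimodular_min :: "'a set \<Rightarrow> 'a algorithm \<Rightarrow> bool" where
  "solves_posimodular_min V A \<longleftrightarrow>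
     (\<forall>f \<in> posimodular_inputs V.
        (\<forall>k X. A (answers A f k) = Query X \<longrightarrow> X \<subseteq> V) \<and>
        (\<exists>X v. outputs A f X v \<and> is_minimum V f X v))"

end

theory Submission
  imports Defs
begin

text \<open>
  Adversary argument. Compare the cardinality function, whose minimum over nonempty sets is
  \<open>1\<close>, with the function \<open>hidden S\<close> that agrees with it except that subsets \<open>X\<close> of \<open>S\<close>
  get the value \<open>min |X| (|S| - |X|)\<close>, so that \<open>S\<close> has value \<open>0\<close>. Both are posimodular, and with
  \<open>|S| = 2m\<close> only queries \<open>X \<subseteq> S\<close> with \<open>|X| > m\<close> tell them apart. So the queries made on the
  cardinality function must, for each \<open>S\<close> of size \<open>2m\<close>, include such an \<open>X\<close>. If \<open>4m \<le> n\<close>, each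
  \<open>X\<close> accounts for at most a fraction \<open>2\<^sup>-\<^sup>m\<close> of all \<open>S\<close>, whence at least \<open>2\<^sup>m\<close> queries; taking
  \<open>m = \<lfloor>n/4\<rfloor>\<close> even gives the stronger bound of order \<open>2 powr (n/4)\<close>.
\<close>

text \<open>Each query is determined by the answers before it, so two runs can diverge only after a
  query on which the oracles differ; agreement is asked only at the queries made on
  \<open>f\<close>.\<close>

lemma answers_cong:
  assumes "\<And>i X. i < j \<Longrightarrow> A (answers A f i) = Query X \<Longrightarrow> f X = g X"
  shows "answers A f j = answers A g j"
  using assms
proof (induction j)
  case (Suc j)
  have "answers A f j = answers A g j"
    by (rule Suc.IH) (rule Suc.prems, simp_all)
  with Suc.prems[of j] show ?case by (auto split: move.split)
qed simp

lemma answers_after_output: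
  assumes "A (answers A f k) = Output X v" "k \<le> j"
  shows "answers A f j = answers A f k"
  using assms(2) by (induction j rule: dec_induct) (simp_all add: assms(1))

lemma outputs_unique:
  assumes "outputs A f X v" "outputs A f X' v'"
  shows "X = X' \<and> v = v'"
proof -
  obtain k k' where k: "A (answers A f k) = Output X v" "A (answers A f k') = Output X' v'"
    using assms by (auto simp: outputs_def)
  have "answers A f (max k k') = answers A f k" "answers A f (max k k') = answers A f k'"
    using k by (auto intro: answers_after_output)
  with k show ?thesis by (metis move.inject(2))
qed

lemma num_calls_output:
  assumes "outputs A f X v"
  shows "A (answers A f (num_calls A f)) = Output X v"
proof -
  have "\<exists>k X v. A (answers A f k) = Output X v"
    using assms by (auto simp: outputs_def)
  then have "\<exists>X v. A (answers A f (num_calls A f)) = Output X v"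
    unfolding num_calls_def by (rule LeastI_ex)
  then show ?thesis
    using outputs_unique[OF assms] by (auto simp: outputs_def)
qed

definition hidden :: "'a set \<Rightarrow> 'a set \<Rightarrow> real" where
  "hidden S X = (if X \<subseteq> S then min (real (card X)) (real (card S) - real (card X))
                 else real (card X))"

lemma hidden_le_card: "hidden S X \<le> card X"
  by (simp add: hidden_def)

text \<open>Monotonicity suffices: \<open>X - Y \<subseteq> X\<close> and
  \<open>Y - X \<subseteq> Y\<close>.\<close>

lemma posimodular_card:
  assumes "finite V"
  shows "posimodular_on V (\<lambda>X. real (card X))"
  unfolding posimodular_on_def
  by (metis Diff_subset add_mono assms card_mono finite_subset of_nat_mono)

lemma posimodular_hidden:
  assumes "finite V" "S \<subseteq> V"
  shows "posimodular_on V (hidden S)"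
  unfolding posimodular_on_def
proof (intro allI impI)
  fix X Y assume "X \<subseteq> V" "Y \<subseteq> V"
  with assms have fin: "finite X" "finite Y" "finite S" by (auto intro: finite_subset)
  have X: "real (card X) = card (X - Y) + card (X \<inter> Y)"
    and Y: "real (card Y) = card (Y - X) + card (X \<inter> Y)"
    using card_Int_Diff[of X Y] card_Int_Diff[of Y X] fin by (auto simp: Int_commute)
  consider "X \<subseteq> S" "Y \<subseteq> S" | "X \<subseteq> S" "\<not> Y \<subseteq> S" | "\<not> X \<subseteq> S" "Y \<subseteq> S"
    | "\<not> X \<subseteq> S" "\<not> Y \<subseteq> S" by blast
  then show "hidden S X + hidden S Y \<ge> hidden S (X - Y) + hidden S (Y - X)"
  proof cases
    case 1
    then have "card (X \<union> Y) \<le> card S" using fin by (intro card_mono) auto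
    moreover have "real (card (X \<union> Y)) + card (X \<inter> Y) = real (card X) + card Y"
      using card_Un_Int[OF fin(1,2)] by simp
    \<comment> \<open>Thus |S| - |X| is at least |Y - X|, and symmetrically. This settles the case
      where the minima for \<open>X\<close> and \<open>Y\<close> are both the complementary terms;
      if only one is, |X \<inter> Y| cancels.\<close>
    ultimately have "real (card (X - Y)) + card (Y - X) + card (X \<inter> Y) \<le> card S"
      using X Y by linarith
    moreover have "X - Y \<subseteq> S" "Y - X \<subseteq> S" using 1 by auto
    ultimately show ?thesis using 1 X Y by (simp add: hidden_def min_def)
  next
    case 2
    \<comment> \<open>The value of \<open>X\<close> is at most |X \<inter> Y| below that of
      \<open>X - Y\<close>, and |Y| exceeds |Y - X| by exactly that amount.\<close>
    then have "X - Y \<subseteq> S" "\<not> Y - X \<subseteq> S" by auto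
    with 2 show ?thesis using X Y by (simp add: hidden_def min_def)
  next
    case 3
    then have "\<not> X - Y \<subseteq> S" "Y - X \<subseteq> S" by auto
    with 3 show ?thesis using X Y by (simp add: hidden_def min_def)
  next
    case 4
    then show ?thesis
      using X Y hidden_le_card[of S "X - Y"] hidden_le_card[of S "Y - X"]
      by (simp add: hidden_def)
  qed
qed

text \<open>Every such \<open>S\<close> is \<open>T \<union> W\<close> with
  \<open>T = S - W\<close>, and a surjection is enough for an upper bound.\<close>

lemma card_supersets_le:
  assumes "finite V" "W \<subseteq> V"
  shows "card {S. W \<subseteq> S \<and> S \<subseteq> V \<and> card S = k} \<le> (card V - card W) choose (k - card W)"
proof -
  let ?T = "{T. T \<subseteq> V - W \<and> card T = k - card W}"
  have "S \<in> (\<lambda>T. T \<union> W) ` ?T" if "W \<subseteq> S" "S \<subseteq> V" "card S = k" for S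
  proof
    show "S = (S - W) \<union> W" using that by auto
    show "S - W \<in> ?T"
      using that assms by (auto simp: card_Diff_subset finite_subset)
  qed
  then have "card {S. W \<subseteq> S \<and> S \<subseteq> V \<and> card S = k} \<le> card ?T"
    using assms by (intro surj_card_le[where f = "\<lambda>T. T \<union> W"]) auto
  also have "\<dots> = (card V - card W) choose (k - card W)"
    using assms by (simp add: n_subsets card_Diff_subset finite_subset)
  finally show ?thesis .
qed

text \<open>Lowering both arguments of \<open>n choose k\<close> by one multiplies it by k/n, which
  is at most 1/2, and preserves \<open>2 * k \<le> n\<close>; so the factor 2 is gained
  \<open>j\<close> times.\<close>

lemma choose_diff_le:
  assumes "2 * k \<le> n" "j \<le> k"
  shows "2 ^ j * ((n - j) choose (k - j)) \<le> n choose k"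
  using assms
proof (induction j arbitrary: n k)
  case (Suc j)
  obtain n' k' where n': "n = Suc n'" "k = Suc k'"
    using Suc.prems by (cases n; cases k) auto
  have "2 ^ j * ((n' - j) choose (k' - j)) \<le> n' choose k'"
    using Suc n' by simp
  moreover have "2 * (n' choose k') \<le> Suc n' choose Suc k'"
  proof -
    have "(2 * Suc k') * (n' choose k') \<le> Suc n' * (n' choose k')"
      using Suc.prems n' by (intro mult_le_mono1) simp
    then have "Suc k' * (2 * (n' choose k')) \<le> Suc k' * (Suc n' choose Suc k')"
      by (simp only: Suc_times_binomial_eq ac_simps)
    then show ?thesis by (simp only: Suc_mult_le_cancel1)
  qed
  ultimately show ?case by (simp add: n')
qed simp

lemma num_calls_card_ge:
  fixes V :: "'a set"
  assumes V: "finite V" and A: "solves_posimodular_min V A"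
    and m: "0 < m" "4 * m \<le> card V"
  shows "2 ^ m \<le> num_calls A (\<lambda>X. real (card X))"
proof -
  define c where "c = (\<lambda>X :: 'a set. real (card X))"
  define N where "N = num_calls A c"
  define F where "F = {S. S \<subseteq> V \<and> card S = 2 * m}"
  \<comment> \<open>\<open>F\<close> holds the candidates for the hidden set; \<open>D i\<close>
    holds those that query \<open>i\<close> of the run on \<open>c\<close> would expose.\<close>
  define D where "D i = {S \<in> F. \<exists>X. A (answers A c i) = Query X \<and> X \<subseteq> S \<and> m < card X}" for i
  have "c \<in> posimodular_inputs V"
    using V by (simp add: c_def posimodular_inputs_def posimodular_card)
  then obtain X v where out: "outputs A c X v" and min: "is_minimum V c X v"
    and queries: "\<And>k X. A (answers A c k) = Query X \<Longrightarrow> X \<subseteq> V"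
    using A unfolding solves_posimodular_min_def by blast
  have "v > 0"
  proof -
    have "finite X" "X \<noteq> {}" "v = card X"
      using min V by (auto simp: is_minimum_def c_def intro: finite_subset)
    then show ?thesis by (simp add: card_gt_0_iff)
  qed
  have "S \<in> (\<Union>i<N. D i)" if "S \<in> F" for S
  proof (rule ccontr)
    assume undetected: "S \<notin> (\<Union>i<N. D i)"
    have S: "S \<subseteq> V" "card S = 2 * m" "S \<noteq> {}" using that m by (auto simp: F_def)
    have "answers A c N = answers A (hidden S) N"
    proof (rule answers_cong)
      fix i X assume "i < N" "A (answers A c i) = Query X"
      moreover have "S \<notin> D i" using undetected \<open>i < N\<close> by blast
      ultimately have "X \<subseteq> S \<longrightarrow> card X \<le> m" using that by (simp add: D_def not_less)
      \<comment> \<open>For \<open>X \<subseteq> S\<close> with \<open>card X \<le> m\<close>, the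
        minimum in \<open>hidden\<close> is \<open>card X\<close>, because
        \<open>card S = 2 * m\<close>.\<close>
      then show "c X = hidden S X" using S by (auto simp: c_def hidden_def)
    qed
    then have "A (answers A (hidden S) N) = Output X v"
      using num_calls_output[OF out, folded N_def] by simp
    then have "outputs A (hidden S) X v"
      unfolding outputs_def by (rule exI)
    moreover have "hidden S \<in> posimodular_inputs V"
      using posimodular_hidden[OF V S(1)] by (simp add: posimodular_inputs_def hidden_def)
    then obtain X' v' where "outputs A (hidden S) X' v'" "is_minimum V (hidden S) X' v'"
      using A unfolding solves_posimodular_min_def by blast
    ultimately have "is_minimum V (hidden S) X v"
      using outputs_unique[of A "hidden S" X v X' v'] by simp
    then have "v = Min {hidden S Y | Y. Y \<subseteq> V \<and> Y \<noteq> {}}" by (simp add: is_minimum_def)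
    also have "\<dots> \<le> hidden S S"
      using S V by (intro Min_le) auto
    also have "\<dots> = 0" by (simp add: hidden_def)
    finally show False using \<open>v > 0\<close> by simp
  qed
  then have cover: "F \<subseteq> (\<Union>i<N. D i)" by blast
  have F: "finite F" "card F = card V choose (2 * m)"
    using V by (simp_all add: F_def n_subsets)
  have D: "2 ^ m * card (D i) \<le> card F" for i
  \<comment> \<open>Only such a query can expose a candidate: a larger set fits into none.\<close>
  proof (cases "\<exists>X. A (answers A c i) = Query X \<and> m < card X \<and> card X \<le> 2 * m")
    case True
    then obtain X where X: "A (answers A c i) = Query X" "m < card X" "card X \<le> 2 * m" by blast
    have "D i = {S. X \<subseteq> S \<and> S \<subseteq> V \<and> card S = 2 * m}"
      using X by (auto simp: D_def F_def)
    then have "card (D i) \<le> (card V - card X) choose (2 * m - card X)"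
      using card_supersets_le[OF V queries[OF X(1)]] by simp
    \<comment> \<open>Raising the exponent from \<open>m\<close> to \<open>card X\<close> gives the
      form of \<open>choose_diff_le\<close>, whose condition \<open>2 * k \<le> n\<close> becomes
      \<open>4 * m \<le> card V\<close>.\<close>
    then have "2 ^ m * card (D i) \<le> 2 ^ card X * ((card V - card X) choose (2 * m - card X))"
      using X by (intro mult_mono power_increasing) auto
    also have "\<dots> \<le> card F"
      using choose_diff_le[of "2 * m" "card V" "card X"] X m F by simp
    finally show ?thesis .
  next
    case False
    then have "D i = {}"
      using V by (auto simp: D_def F_def) (metis card_mono finite_subset)
    then show ?thesis by simp
  qed
  have "card F \<le> card (\<Union>i<N. D i)"
    using cover F by (intro card_mono) (auto simp: D_def)
  also have "\<dots> \<le> (\<Sum>i<N. card (D i))" by (intro card_UN_le) simp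
  finally have "2 ^ m * card F \<le> (\<Sum>i<N. 2 ^ m * card (D i))"
    by (simp flip: sum_distrib_left)
  also have "\<dots> \<le> N * card F" using sum_bounded_above[of "{..<N}", OF D] by simp
  finally have "2 ^ m * card F \<le> N * card F" .
  moreover have "card F > 0" using F m by simp
  ultimately show ?thesis by (simp add: N_def c_def)
qed

theorem theorem1:
  "\<exists>g :: nat \<Rightarrow> nat.
     (\<lambda>n. real (g n)) \<in> \<Omega>(\<lambda>n. 2 powr (real n / 7.54)) \<and>
     (\<forall>(V :: 'a set) A. finite V \<longrightarrow> solves_posimodular_min V A \<longrightarrow>
        (\<exists>f \<in> posimodular_inputs V. num_calls A f \<ge> g (card V)))"
proof (intro exI conjI allI impI)
  \<comment> \<open>For \<open>n < 4\<close> the choice \<open>m = n div 4\<close> would violate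
    \<open>0 < m\<close>; finitely many values do not affect the asymptotic bound.\<close>
  let ?g = "\<lambda>n::nat. if n < 4 then 0 else 2 ^ (n div 4) :: nat"
  show "(\<lambda>n. real (?g n)) \<in> \<Omega>(\<lambda>n. 2 powr (real n / 7.54))"
  proof (rule landau_omega.bigI[of "1/2"])
    show "\<forall>\<^sub>F n in sequentially. norm (real (?g n)) \<ge> 1/2 * norm (2 powr (real n / 7.54))"
      using eventually_ge_at_top[of 4]
    proof eventually_elim
      case (elim n)
      \<comment> \<open>The remainder costs at most 3/7.54 < 1 in the exponent, hence a factor below
        2, matched by the constant 1/2.\<close>
      have "real n \<le> 4 * real (n div 4) + 3" by linarith
      then have "2 powr (real n / 7.54) \<le> 2 powr (real (n div 4) + 1)"
        by (intro powr_mono) (auto simp: field_simps)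
      also have "\<dots> = 2 * 2 ^ (n div 4)" by (simp add: powr_add powr_realpow)
      finally show ?case using elim by simp
    qed
  qed simp
  fix V :: "'a set" and A :: "'a algorithm"
  assume "finite V" "solves_posimodular_min V A"
  then have "num_calls A (\<lambda>X. real (card X)) \<ge> ?g (card V)"
    using num_calls_card_ge[of V A "card V div 4"] by auto
  moreover have "(\<lambda>X. real (card X)) \<in> posimodular_inputs V"
    using \<open>finite V\<close> by (simp add: posimodular_inputs_def posimodular_card)
  ultimately show "\<exists>f \<in> posimodular_inputs V. num_calls A f \<ge> ?g (card V)" by blast
qed

end
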